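(* Let $G$ be a nontrivial connected graph of order $n$. Then $0\leq spvc(G)\leq n-2$. Equality on the right-hand side (that is, $spvc(G)=n-2$) is attained if and only if $G\in\{P_3,P_4\}$, where $P_m$ denotes the path on $m$ vertices.
   Context: All graphs are simple, finite and undirected; the order of a graph is its number of vertices, and a graph is nontrivial if it has at least two vertices. Vertex-colorings are arbitrary (adjacent vertices may receive the same color). A path in a vertex-colored graph is a vertex-proper path if any two internal adjacent vertices of the path differ in color (the end-vertices are not internal). A $u$-$v$ geodesic is a $u$-$v$ path of length $d(u,v)$, where $d(u,v)$ is the distance between $u$ and $v$. A vertex-colored graph is strong proper vertex-connected if for any two vertices $u,v$ of the graph there exists a vertex-proper $u$-$v$ geodesic. For a connected graph $G$, the strong proper vertex-connection number $spvc(G)$ is the smallest number of colors required to make $G$ strong proper vertex-connected. The value $0$ is allowed: $spvc(G)=0$ if and only if $G$ is a complete graph, and $spvc(G)=1$ if and only if $G$ has diameter $2$.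
   Formalization: The equality characterization is stated only for n ≥ 3, because it fails for n = 2: the complete graph K_2 has spvc = 0 = n−2 but is neither P_3 nor P_4. The bounds are stated for all n ≥ 2. *)

theory Defs
  imports "Graph_Theory.Graph_Theory"
begin

text \<open>
  Simple finite undirected graphs are symmetric digraphs without loops and parallel arcs,
  that is, the locale \<open>graph\<close>; the edges are the pairs in \<open>arcs_ends G\<close>.
  Paths are represented by their lists of vertices.
\<close>

definition path_between :: "('a, 'b) pre_digraph \<Rightarrow> 'a \<Rightarrow> 'a vwalk \<Rightarrow> 'a \<Rightarrow> bool" where
  "path_between G u p v \<longleftrightarrow> vpath p G \<and> hd p = u \<and> last p = v"

text \<open>Unspecified if no path joins the two vertices.\<close>

definition graph_dist :: "('a, 'b) pre_digraph \<Rightarrow> 'a \<Rightarrow> 'a \<Rightarrow> nat" where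
  "graph_dist G u v = (LEAST k. \<exists>p. path_between G u p v \<and> vwalk_length p = k)"

definition geodesic :: "('a, 'b) pre_digraph \<Rightarrow> 'a \<Rightarrow> 'a vwalk \<Rightarrow> 'a \<Rightarrow> bool" where
  "geodesic G u p v \<longleftrightarrow> path_between G u p v \<and> vwalk_length p = graph_dist G u v"

definition internal_verts :: "'a vwalk \<Rightarrow> 'a list" where
  "internal_verts p = butlast (tl p)"

text \<open>\<open>vwalk_arcs\<close> lists the pairs of consecutive vertices.\<close>

definition vertex_proper :: "('a \<Rightarrow> 'c) \<Rightarrow> 'a vwalk \<Rightarrow> bool" where
  "vertex_proper c p \<longleftrightarrow> (\<forall>(x, y) \<in> set (vwalk_arcs (internal_verts p)). c x \<noteq> c y)"

definition strong_proper_vertex_connected ::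
    "('a, 'b) pre_digraph \<Rightarrow> ('a \<Rightarrow> 'c) \<Rightarrow> bool" where
  "strong_proper_vertex_connected G c \<longleftrightarrow>
    (\<forall>u \<in> verts G. \<forall>v \<in> verts G. \<exists>p. geodesic G u p v \<and> vertex_proper c p)"

text \<open>
  Since a nonempty vertex set has no coloring with zero colors, the convention that the number
  is 0 for complete graphs (whose geodesics have no internal vertices) is a separate case.
\<close>

definition spvc :: "('a, 'b) pre_digraph \<Rightarrow> nat" where
  "spvc G =
    (if complete_digraph (card (verts G)) G then 0
     else (LEAST k. \<exists>c :: 'a \<Rightarrow> nat.
       c ` verts G \<subseteq> {..<k} \<and> strong_proper_vertex_connected G c))"

definition path_graph :: "nat \<Rightarrow> nat pair_pre_digraph" where
  "path_graph m =
    \<lparr> pverts = {..<m}, parcs = {(i, j). i < m \<and> j < m \<and> (j = Suc i \<or> i = Suc j)} \<rparr>"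

end

theory Submission
  imports Defs
begin

text \<open>
  A coloring is good as soon as every walk a-x-y-b with x and y of the same color has ends at
  distance at most two, since then x and y are never consecutive internal vertices of a geodesic.
  If a constant coloring fails this test, there is a geodesic v0-v1-v2-v3. Being an induced path, it
  can be properly colored with two colors, and giving all other vertices private colors
  uses \<open>n - 2\<close> colors. If there is a further vertex, one more color can be saved: this is
  clear if some further vertex has no neighbor in one of the two color classes, or if two further
  vertices are nonadjacent. Otherwise the further vertices form a clique, and some vertex w
  among them can take the color of a path vertex x so that w is adjacent to all neighbors of x,
  or else all of them are adjacent to exactly v1 and v2 on the path, and any w can take the
  color of v2.
\<close>

definition (in pre_digraph) locally_proper :: "('a \<Rightarrow> 'c) \<Rightarrow> bool" where
  "locally_proper c \<longleftrightarrow>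
    (\<forall>a x y b. a \<rightarrow> x \<longrightarrow> x \<rightarrow> y \<longrightarrow> y \<rightarrow> b \<longrightarrow> c x = c y \<longrightarrow>
      a = b \<or> a \<rightarrow> b \<or> (\<exists>z. a \<rightarrow> z \<and> z \<rightarrow> b))"

section \<open>Walks, distances and internal vertices\<close>

lemma length_vwalk_to_vpath_le:
  assumes "vwalk p G"
  shows "length (vwalk_to_vpath p) \<le> length p"
proof -
  have "distinct (vwalk_to_vpath p)"
    using vwalk_to_vpath_vpath[OF assms] by (simp add: vpath_def)
  then have "length (vwalk_to_vpath p) = card (set (vwalk_to_vpath p))"
    by (simp add: distinct_card)
  also have "\<dots> \<le> card (set p)"
    by (intro card_mono) (auto dest: vwalk_to_vpath_subset)
  also have "\<dots> \<le> length p" by (rule card_length)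
  finally show ?thesis .
qed

text \<open>Every walk contains a path with the same ends, so walks already bound distances from
  above. The bound is strict because \<open>length\<close> counts vertices, one more than
  arcs.\<close>

lemma graph_dist_less_length:
  assumes "vwalk p G"
  shows "graph_dist G (hd p) (last p) < length p"
proof -
  let ?q = "vwalk_to_vpath p"
  have "path_between G (hd p) ?q (last p)"
    using vwalk_to_vpath_vpath[OF assms]
    by (simp add: path_between_def vwalk_to_vpath_hd vwalk_to_vpath_last)
  then have "graph_dist G (hd p) (last p) \<le> vwalk_length ?q"
    unfolding graph_dist_def by (intro Least_le) blast
  also have "\<dots> < length p"
    using length_vwalk_to_vpath_le[OF assms] assms by (cases p) (auto simp: vwalk_def)
  finally show ?thesis .
qed

lemma in_vwalk_arcs_split:
  "(x, y) \<in> set (vwalk_arcs p) \<Longrightarrow> \<exists>as bs. p = as @ x # y # bs"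
proof (induction p rule: vwalk_arcs.induct)
  case (3 u v p)
  then show ?case
    by (metis (no_types, lifting) append_Cons append_Nil prod.inject set_ConsD vwalk_arcs.simps(3))
qed auto

text \<open>Only the two ends of \<open>p\<close> are deleted, so two consecutive internal vertices
  still have a predecessor and a successor in \<open>p\<close>.\<close>

lemma internal_arc_split:
  assumes "(x, y) \<in> set (vwalk_arcs (internal_verts p))"
  obtains as a b bs where "p = as @ a # x # y # b # bs"
proof -
  obtain cs ds where "butlast (tl p) = cs @ x # y # ds"
    using in_vwalk_arcs_split[OF assms] by (auto simp: internal_verts_def)
  \<comment> \<open>The internal part is nonempty, so \<open>p\<close> has a first and a last vertex
    that enclose it.\<close>
  then have "p = (hd p # cs) @ x # y # ds @ [last p]"
    by (metis append.assoc append_Cons append_Nil append_butlast_last_id butlast.simps(1)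
        last_tl list.collapse list.distinct(1) list.sel(2) append_is_Nil_conv)
  moreover obtain as a where "hd p # cs = as @ [a]"
    by (metis list.distinct(1) rev_exhaust)
  moreover obtain b bs where "ds @ [last p] = b # bs"
    by (cases ds) auto
  ultimately show thesis using that[of as a b bs] by simp
qed

section \<open>Locally proper colorings and isomorphism with path graphs\<close>

context graph
begin

lemma adj_sym: "u \<rightarrow> v \<Longrightarrow> v \<rightarrow> u"
  using sym_arcs by (auto simp: symmetric_def sym_def)

lemma adj_irrefl: "\<not> u \<rightarrow> u"
  using no_loops by (auto simp: arcs_ends_conv)

lemma vwalk_append_adj:
  assumes "vwalk p G" "vwalk q G" "last p \<rightarrow> hd q"
  shows "vwalk (p @ q) G"
  using assms by (auto simp: vwalk_def vwalk_arcs_append)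

text \<open>Connectivity provides some path, so the minimum in \<open>graph_dist\<close> ranges over
  a nonempty set and is attained.\<close>

lemma ex_geodesic:
  assumes "connected G" "u \<in> verts G" "v \<in> verts G"
  shows "\<exists>p. geodesic G u p v"
proof -
  have "u \<rightarrow>\<^sup>* v"
    using symmetric_connected_imp_strongly_connected[OF sym_arcs assms(1)] assms(2,3)
    by (auto simp: strongly_connected_def)
  then have "\<exists>p. vwalk p G \<and> hd p = u \<and> last p = v"
    by (auto simp: reachable_vwalk_conv)
  then have "\<exists>p. path_between G u p v"
    using vwalk_imp_ex_vpath by (metis path_between_def)
  then have "\<exists>k p. path_between G u p v \<and> vwalk_length p = k" by blast
  then show ?thesis unfolding geodesic_def graph_dist_def by (rule LeastI_ex)
qed

text \<open>Shortcutting a walk a-x-y-b whose ends are at distance at most two would shorten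
  the geodesic.\<close>

lemma geodesic_vertex_proper:
  assumes "locally_proper c" "geodesic G u p v"
  shows "vertex_proper c p"
  unfolding vertex_proper_def
proof clarify
  fix x y assume xy: "(x, y) \<in> set (vwalk_arcs (internal_verts p))" and c: "c x = c y"
  obtain as a b bs where p: "p = as @ a # x # y # b # bs"
    using internal_arc_split[OF xy] .
  have w: "vwalk p G" and hl: "hd p = u" "last p = v"
    and len: "graph_dist G u v = length p - 1"
    using assms(2) by (auto simp: geodesic_def path_between_def)
  have adj: "a \<rightarrow> x" "x \<rightarrow> y" "y \<rightarrow> b"
    using w p vwalkI_append_r[of "a # x # y # b # bs" as] by (auto simp: vwalk_def)
  have wa: "vwalk (as @ [a]) G"
    using w p vwalkI_append_l[of "as @ [a]" "x # y # b # bs"] by simp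
  have wb: "vwalk (b # bs) G"
    using w p vwalkI_append_r[of "b # bs" "as @ [a, x, y]"] by simp
  \<comment> \<open>A shorter walk is enough for a contradiction, so the shortcuts below need no
    check for repeated vertices.\<close>
  have short: False if "vwalk q G" "hd q = u" "last q = v" "length q < length p" for q
    using graph_dist_less_length[OF that(1)] that len by simp
  consider "a = b" | "a \<rightarrow> b" | z where "a \<rightarrow> z" "z \<rightarrow> b"
    using assms(1) adj c unfolding locally_proper_def by blast
  then show False
  proof cases
    case 1
    \<comment> \<open>Here \<open>a\<close>, \<open>x\<close> and \<open>y\<close> are cut out. An
      empty \<open>as\<close> has no last vertex to be joined to \<open>b\<close>.\<close>
    have "vwalk (as @ b # bs) G"
    proof (cases "as = []")
      case False
      then have "vwalk as G" "last as \<rightarrow> b"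
        using wa 1 vwalkI_append_l[of as "[a]"] by (auto simp: vwalk_def set_vwalk_arcs_snoc)
      then show ?thesis using wb by (intro vwalk_append_adj) auto
    qed (use wb in simp)
    then show False using hl p 1 by (intro short[of "as @ b # bs"]) (auto simp: hd_append)
  next
    case 2
    then have "vwalk ((as @ [a]) @ b # bs) G" using wa wb by (intro vwalk_append_adj[of "as @ [a]"]) auto
    then show False using hl p by (intro short[of "as @ a # b # bs"]) (auto simp: hd_append)
  next
    case 3
    then have "vwalk (z # b # bs) G" using wb by (simp add: vwalk_wf_digraph_consI)
    then have "vwalk ((as @ [a]) @ z # b # bs) G" using wa 3 by (intro vwalk_append_adj[of "as @ [a]"]) auto
    then show False using hl p by (intro short[of "as @ a # z # b # bs"]) (auto simp: hd_append)
  qed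
qed

lemma locally_proper_imp_strong:
  assumes "connected G" "locally_proper c"
  shows "strong_proper_vertex_connected G c"
  using ex_geodesic[OF assms(1)] geodesic_vertex_proper[OF assms(2)]
  unfolding strong_proper_vertex_connected_def by blast

text \<open>The local test depends only on which vertices share a color, so colors of any type can
  be renumbered injectively. Later colorings use vertices as colors.\<close>

lemma ex_strong_coloring:
  assumes "connected G" "locally_proper c"
  shows "\<exists>d :: 'a \<Rightarrow> nat. d ` verts G \<subseteq> {..<card (c ` verts G)} \<and>
    strong_proper_vertex_connected G d"
proof -
  obtain f :: "_ \<Rightarrow> nat" where f: "bij_betw f (c ` verts G) {0..<card (c ` verts G)}"
    using ex_bij_betw_finite_nat[of "c ` verts G"] by auto
  have "locally_proper (f \<circ> c)"
    unfolding locally_proper_def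
  proof (intro allI impI)
    fix a x y b assume *: "a \<rightarrow> x" "x \<rightarrow> y" "y \<rightarrow> b" "(f \<circ> c) x = (f \<circ> c) y"
    then have "x \<in> verts G" "y \<in> verts G" by auto
    then have "c x = c y" using f * by (auto simp: bij_betw_def dest: inj_onD)
    then show "a = b \<or> a \<rightarrow> b \<or> (\<exists>z. a \<rightarrow> z \<and> z \<rightarrow> b)"
      using assms(2) * unfolding locally_proper_def by blast
  qed
  moreover have "(f \<circ> c) ` verts G \<subseteq> {..<card (c ` verts G)}"
    using f by (auto simp: bij_betw_def)
  ultimately show ?thesis using locally_proper_imp_strong[OF assms(1)] by blast
qed

lemma spvc_le_card:
  assumes "connected G" "locally_proper c"
  shows "spvc G \<le> card (c ` verts G)"
  using ex_strong_coloring[OF assms] by (auto simp: spvc_def intro!: Least_le)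

lemma spvc_coloring:
  assumes "connected G" "\<not> complete_digraph (card (verts G)) G"
  obtains c :: "'a \<Rightarrow> nat"
  where "c ` verts G \<subseteq> {..<spvc G}" "strong_proper_vertex_connected G c"
proof -
  \<comment> \<open>Adjacent vertices are distinct, so the identity passes the test vacuously; hence
    the minimum defining \<open>spvc\<close> is attained.\<close>
  have "locally_proper (\<lambda>x :: 'a. x)"
    unfolding locally_proper_def using adj_irrefl by blast
  from ex_strong_coloring[OF assms(1) this]
  have "\<exists>k. \<exists>c :: 'a \<Rightarrow> nat. c ` verts G \<subseteq> {..<k} \<and> strong_proper_vertex_connected G c"
    by blast
  from LeastI_ex[OF this] show thesis using that assms(2) by (auto simp: spvc_def)
qed

text \<open>Turns an isomorphism, which also acts on arcs, into a numbering of the vertices along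
  the path.\<close>

lemma digraph_iso_path_graph_iff:
  "digraph_iso G (with_proj (path_graph m)) \<longleftrightarrow>
    (\<exists>g. bij_betw g {..<m} (verts G) \<and>
      (\<forall>i<m. \<forall>j<m. (g i \<rightarrow> g j) \<longleftrightarrow> j = Suc i \<or> i = Suc j))"
  (is "?L \<longleftrightarrow> ?R")
proof
  assume ?L
  then obtain h where h: "digraph_isomorphism h" and app: "with_proj (path_graph m) = app_iso h G"
    by (auto simp: digraph_iso_def)
  let ?f = "iso_verts h"
  have f: "bij_betw ?f (verts G) {..<m}"
    using h arg_cong[OF app, of verts]
    by (auto simp: bij_betw_def digraph_isomorphism_def path_graph_def)
  have ends: "parcs (path_graph m) = (\<lambda>(u, v). (?f u, ?f v)) ` arcs_ends G"
    using arg_cong[OF app, of arcs_ends] arcs_ends_app_iso_eq[OF h] by simp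
  let ?g = "the_inv_into (verts G) ?f"
  have g: "bij_betw ?g {..<m} (verts G)" using bij_betw_the_inv_into[OF f] .
  have fg: "?f (?g i) = i" if "i < m" for i
    using f that by (auto simp: f_the_inv_into_f_bij_betw)
  have "(?g i \<rightarrow> ?g j) \<longleftrightarrow> j = Suc i \<or> i = Suc j" if ij: "i < m" "j < m" for i j
  proof -
    have "(?g i \<rightarrow> ?g j) \<longleftrightarrow> (i, j) \<in> parcs (path_graph m)"
    proof
      assume "?g i \<rightarrow> ?g j"
      then show "(i, j) \<in> parcs (path_graph m)"
        unfolding ends using fg ij by (force intro: rev_image_eqI)
    next
      assume "(i, j) \<in> parcs (path_graph m)"
      then obtain u v where uv: "u \<rightarrow> v" "i = ?f u" "j = ?f v" unfolding ends by auto
      then have "u \<in> verts G" "v \<in> verts G" by auto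
      then show "?g i \<rightarrow> ?g j"
        using uv f by (simp add: the_inv_into_f_f bij_betw_def)
    qed
    then show ?thesis using ij by (auto simp: path_graph_def)
  qed
  with g show ?R by blast
next
  assume ?R
  then obtain g where g: "bij_betw g {..<m} (verts G)"
    and adj: "\<And>i j. i < m \<Longrightarrow> j < m \<Longrightarrow> (g i \<rightarrow> g j) \<longleftrightarrow> j = Suc i \<or> i = Suc j"
    by blast
  let ?f = "the_inv_into {..<m} g"
  have f: "bij_betw ?f (verts G) {..<m}" using bij_betw_the_inv_into[OF g] .
  have gf: "g (?f u) = u" if "u \<in> verts G" for u
    using g that by (rule f_the_inv_into_f_bij_betw)
  have fg: "?f (g i) = i" if "i < m" for i
    using g that by (auto simp: the_inv_into_f_f bij_betw_def)
  have flt: "?f u < m" if "u \<in> verts G" for u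
    using f that by (auto simp: bij_betw_def)
  \<comment> \<open>The arcs of the path graph are pairs, so each arc goes to the numbers of its two
    ends; without parallel arcs this is injective.\<close>
  define h where "h = \<lparr> iso_verts = ?f, iso_arcs = (\<lambda>e. (?f (tail G e), ?f (head G e))),
    iso_head = snd, iso_tail = fst \<rparr>"
  have "inj_on (iso_arcs h) (arcs G)"
  proof (rule inj_onI)
    fix d e assume de: "d \<in> arcs G" "e \<in> arcs G" "iso_arcs h d = iso_arcs h e"
    then have "?f (tail G d) = ?f (tail G e)" "?f (head G d) = ?f (head G e)"
      by (auto simp: h_def)
    then have "arc_to_ends G d = arc_to_ends G e"
      using de f by (auto simp: arc_to_ends_def bij_betw_def dest: inj_onD)
    then show "d = e" using no_multi_arcs de by blast
  qed
  then have iso: "digraph_isomorphism h"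
    using f wf_digraph by (auto simp: digraph_isomorphism_def h_def bij_betw_def)
  have "iso_arcs h ` arcs G = parcs (path_graph m)"
  proof (intro equalityI subsetI)
    fix q assume "q \<in> iso_arcs h ` arcs G"
    then obtain e where e: "e \<in> arcs G" "q = (?f (tail G e), ?f (head G e))"
      by (auto simp: h_def)
    then have "tail G e \<rightarrow> head G e" by (auto simp: arcs_ends_conv)
    then have "g (?f (tail G e)) \<rightarrow> g (?f (head G e))" using e gf by simp
    then show "q \<in> parcs (path_graph m)" using adj flt e by (simp add: path_graph_def)
  next
    fix q assume "q \<in> parcs (path_graph m)"
    then obtain i j where q: "q = (i, j)" "i < m" "j < m" "j = Suc i \<or> i = Suc j"
      by (auto simp: path_graph_def)
    then have "g i \<rightarrow> g j" using adj by blast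
    then obtain e where e: "e \<in> arcs G" "tail G e = g i" "head G e = g j" by blast
    then have "iso_arcs h e = q" using q fg by (simp add: h_def)
    with e(1) show "q \<in> iso_arcs h ` arcs G" by blast
  qed
  moreover have "iso_verts h ` verts G = pverts (path_graph m)"
    using f by (auto simp: h_def bij_betw_def path_graph_def)
  ultimately have "with_proj (path_graph m) = app_iso h G"
    by (simp add: app_iso_def with_proj_def h_def)
  with iso show ?L unfolding digraph_iso_def by blast
qed

end

section \<open>Graphs with two vertices at distance three\<close>

locale distance_three = graph +
  fixes v0 v1 v2 v3
  assumes conn: "connected G"
    and adj: "v0 \<rightarrow> v1" "v1 \<rightarrow> v2" "v2 \<rightarrow> v3"
    and ends_neq: "v0 \<noteq> v3" and ends_nonadj: "\<not> v0 \<rightarrow> v3"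
    and no_common: "\<And>z. v0 \<rightarrow> z \<Longrightarrow> z \<rightarrow> v3 \<Longrightarrow> False"
begin

lemma adj_rev: "v1 \<rightarrow> v0" "v2 \<rightarrow> v1" "v3 \<rightarrow> v2"
  using adj adj_sym by blast+

text \<open>A chord from \<open>v0\<close> to \<open>v2\<close> or from \<open>v1\<close> to
  \<open>v3\<close> would create a common neighbor of \<open>v0\<close> and
  \<open>v3\<close>.\<close>

lemma nonadj: "\<not> v0 \<rightarrow> v2" "\<not> v2 \<rightarrow> v0" "\<not> v1 \<rightarrow> v3" "\<not> v3 \<rightarrow> v1" "\<not> v3 \<rightarrow> v0"
  using adj no_common ends_nonadj adj_sym by blast+

lemma path_distinct: "distinct [v0, v1, v2, v3]"
  using adj adj_irrefl nonadj ends_neq ends_nonadj by auto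

lemma path_verts: "{v0, v1, v2, v3} \<subseteq> verts G"
  using adj by auto

text \<open>The induced path uses two colors; every other vertex represents its own color.\<close>

definition base :: "'a \<Rightarrow> 'a" where
  "base = id (v2 := v0, v3 := v1)"

lemma base_eqD:
  assumes "base x = base y" "x \<noteq> y"
  shows "{x, y} = {v0, v2} \<or> {x, y} = {v1, v3}"
  using assms path_distinct by (auto simp: base_def split: if_splits)

text \<open>Vertices with equal \<open>base\<close> color are nonadjacent, so the local test is
  vacuous; \<open>v2\<close> and \<open>v3\<close> never occur as colors.\<close>

lemma spvc_le: "spvc G \<le> card (verts G) - 2"
proof -
  have "base x \<noteq> base y" if "x \<rightarrow> y" for x y
    using base_eqD[of x y] that nonadj adj_irrefl by (auto simp: doubleton_eq_iff)
  then have "locally_proper base" unfolding locally_proper_def by blast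
  then have "spvc G \<le> card (base ` verts G)" using conn by (intro spvc_le_card)
  also have "\<dots> \<le> card (verts G - {v2, v3})"
    using path_verts path_distinct by (intro card_mono) (auto simp: base_def)
  also have "\<dots> = card (verts G) - 2"
    using path_verts path_distinct by (simp add: card_Diff_subset)
  finally show ?thesis .
qed

text \<open>Recoloring \<open>w\<close> with \<open>s\<close> also frees the color \<open>w\<close>.
  New monochromatic edges can only join \<open>w\<close> to the color class of \<open>s\<close>, and
  \<open>near\<close> is the local test for these.\<close>

lemma spvc_le_merge:
  assumes w: "w \<in> verts G - {v0, v1, v2, v3}" and s: "s \<in> verts G - {v2, v3, w}"
    and near: "\<And>a x b. a \<rightarrow> w \<Longrightarrow> w \<rightarrow> x \<Longrightarrow> x \<rightarrow> b \<Longrightarrow> base x = s \<Longrightarrow>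
      a = b \<or> a \<rightarrow> b \<or> (\<exists>z. a \<rightarrow> z \<and> z \<rightarrow> b)"
  shows "spvc G \<le> card (verts G) - 3"
proof -
  let ?c = "base (w := s)"
  have "locally_proper ?c"
    unfolding locally_proper_def
  proof (intro allI impI)
    fix a x y b assume *: "a \<rightarrow> x" "x \<rightarrow> y" "y \<rightarrow> b" "?c x = ?c y"
    have "x \<noteq> y" using * adj_irrefl by blast
    moreover have "base x \<noteq> base y"
      using base_eqD[of x y] * nonadj adj_irrefl by (auto simp: doubleton_eq_iff)
    ultimately consider "x = w" "base y = s" | "y = w" "base x = s"
      using *(4) by (auto split: if_splits)
    then show "a = b \<or> a \<rightarrow> b \<or> (\<exists>z. a \<rightarrow> z \<and> z \<rightarrow> b)"
    proof cases
      case 1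
      then show ?thesis using near * by blast
    next
      case 2
      \<comment> \<open>The same walk read backwards.\<close>
      then show ?thesis using near[of b x a] * adj_sym by blast
    qed
  qed
  then have "spvc G \<le> card (?c ` verts G)" using conn by (intro spvc_le_card)
  also have "\<dots> \<le> card (verts G - {v2, v3, w})"
    using path_verts path_distinct w s by (intro card_mono) (auto simp: base_def)
  also have "\<dots> = card (verts G) - 3"
    using path_verts path_distinct w by (subst card_Diff_subset) auto
  finally show ?thesis .
qed

lemma base_eq_iff:
  assumes "x \<notin> {v0, v1, v2, v3}"
  shows "base y = x \<longleftrightarrow> y = x"
  using assms path_distinct by (auto simp: base_def)

lemma base_eq_v0: "base y = v0 \<longleftrightarrow> y = v0 \<or> y = v2"
  and base_eq_v1: "base y = v1 \<longleftrightarrow> y = v1 \<or> y = v3"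
  using path_distinct by (auto simp: base_def)

lemma spvc_le_five:
  assumes "5 \<le> card (verts G)"
  shows "spvc G \<le> card (verts G) - 3"
proof -
  define W where "W = verts G - {v0, v1, v2, v3}"
  note merge = spvc_le_merge[folded W_def]
  have v: "v0 \<in> verts G" "v1 \<in> verts G" "v2 \<in> verts G" "v3 \<in> verts G"
    using path_verts by auto
  have "card W \<noteq> 0"
    using assms path_verts path_distinct unfolding W_def by (simp add: card_Diff_subset)
  then obtain w0 where w0: "w0 \<in> W" by fastforce
  show ?thesis
  proof (cases "\<exists>w\<in>W. \<exists>w'\<in>W. w \<noteq> w' \<and> \<not> w \<rightarrow> w'")
    case True
    then obtain w w' where w: "w \<in> W" "w' \<in> W" "w \<noteq> w'" "\<not> w \<rightarrow> w'" by blast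
    \<comment> \<open>The color \<open>w'\<close> belongs to \<open>w'\<close> alone, so
      \<open>w\<close> may share it without a monochromatic edge.\<close>
    then have "base x \<noteq> w'" if "w \<rightarrow> x" for x
      using that base_eq_iff[of w' x] by (auto simp: W_def)
    then show ?thesis using merge[of w w'] w by (auto simp: W_def)
  next
    case False
    then have clique: "w \<rightarrow> w'" if "w \<in> W" "w' \<in> W" "w \<noteq> w'" for w w'
      using that by blast
    have nbr: "b \<in> {v0, v1, v2, v3} \<or> b \<in> W" if "y \<rightarrow> b" for y b
      using that by (auto simp: W_def)
    \<comment> \<open>Either \<open>b\<close> is on the path and adjacent to \<open>w\<close>, or it
      lies in the clique, so it equals \<open>w\<close> or is adjacent to it. Thus \<open>a\<close>
      reaches \<open>b\<close> directly or through \<open>w\<close>.\<close>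
    have dominated: "a = b \<or> a \<rightarrow> b \<or> (\<exists>z. a \<rightarrow> z \<and> z \<rightarrow> b)"
      if "w \<in> W" "a \<rightarrow> w" "x \<rightarrow> b"
        "\<And>y. x \<rightarrow> y \<Longrightarrow> y \<in> {v0, v1, v2, v3} \<Longrightarrow> w \<rightarrow> y" for w x a b
      using nbr[OF that(3)] that clique[of w b] by metis
    \<comment> \<open>If the first six cases fail, \<open>w\<close> is adjacent to both or neither
      of \<open>v1\<close> and \<open>v2\<close>. Neither would force \<open>v0\<close> and
      \<open>v3\<close> as neighbors, against \<open>no_common\<close>; with both,
      \<open>adj02\<close> and \<open>adj13\<close> rule out \<open>v0\<close> and
      \<open>v3\<close>.\<close>
    consider (nonadj02) w where "w \<in> W" "\<not> w \<rightarrow> v0" "\<not> w \<rightarrow> v2"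
      | (nonadj13) w where "w \<in> W" "\<not> w \<rightarrow> v1" "\<not> w \<rightarrow> v3"
      | (adj01) w where "w \<in> W" "w \<rightarrow> v1" "\<not> w \<rightarrow> v2"
      | (adj23) w where "w \<in> W" "w \<rightarrow> v2" "\<not> w \<rightarrow> v1"
      | (adj02) w where "w \<in> W" "w \<rightarrow> v0" "w \<rightarrow> v2" "\<not> w \<rightarrow> v3"
      | (adj13) w where "w \<in> W" "w \<rightarrow> v1" "w \<rightarrow> v3" "\<not> w \<rightarrow> v0"
      | (middle) "\<forall>w\<in>W. w \<rightarrow> v1 \<and> w \<rightarrow> v2 \<and> \<not> w \<rightarrow> v0 \<and> \<not> w \<rightarrow> v3"
      using no_common adj_sym by blast
    then show ?thesis
    proof cases
      case nonadj02
      then show ?thesis using merge[of w v0] v path_distinct by (auto simp: W_def base_eq_v0)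
    next
      case nonadj13
      then show ?thesis using merge[of w v1] v path_distinct by (auto simp: W_def base_eq_v1)
    next
      case adj01
      \<comment> \<open>On the path \<open>v0\<close> has only the neighbor \<open>v1\<close>. As
        \<open>w\<close> is not adjacent to \<open>v2\<close>, the color \<open>v0\<close> can
        conflict only along the edge from \<open>w\<close> to \<open>v0\<close>.\<close>
      have "w \<rightarrow> y" if "v0 \<rightarrow> y" "y \<in> {v0, v1, v2, v3}" for y
        using that adj01 nonadj ends_nonadj adj_irrefl by auto
      then show ?thesis
        using merge[of w v0] dominated[of w _ v0] adj01 v path_distinct
        by (auto simp: W_def base_eq_v0)
    next
      case adj23
      \<comment> \<open>Mirror image: \<open>v3\<close> has color \<open>v1\<close>, and
        \<open>w\<close> is not adjacent to \<open>v1\<close> itself.\<close>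
      have "w \<rightarrow> y" if "v3 \<rightarrow> y" "y \<in> {v0, v1, v2, v3}" for y
        using that adj23 nonadj ends_nonadj adj_irrefl by auto
      then show ?thesis
        using merge[of w v1] dominated[of w _ v3] adj23 v path_distinct
        by (auto simp: W_def base_eq_v1)
    next
      case adj02
      \<comment> \<open>Now the inner vertex \<open>v1\<close> is dominated: its path neighbors are
        \<open>v0\<close> and \<open>v2\<close>. The next case is its mirror image.\<close>
      have "w \<rightarrow> y" if "v1 \<rightarrow> y" "y \<in> {v0, v1, v2, v3}" for y
        using that adj02 nonadj ends_nonadj adj_irrefl by auto
      then show ?thesis
        using merge[of w v1] dominated[of w _ v1] adj02 v path_distinct
        by (auto simp: W_def base_eq_v1)
    next
      case adj13
      have "w \<rightarrow> y" if "v2 \<rightarrow> y" "y \<in> {v0, v1, v2, v3}" for y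
        using that adj13 nonadj ends_nonadj adj_irrefl by auto
      then show ?thesis
        using merge[of w v0] dominated[of w _ v2] adj13 v path_distinct
        by (auto simp: W_def base_eq_v0)
    next
      case middle
      \<comment> \<open>Every neighbor of \<open>w0\<close> is \<open>v2\<close> or adjacent to
        \<open>v2\<close>, so \<open>v2\<close> itself gives the shortcut; in its color class,
        \<open>w0\<close> is adjacent to \<open>v2\<close> only.\<close>
      have "a = b \<or> a \<rightarrow> b \<or> (\<exists>z. a \<rightarrow> z \<and> z \<rightarrow> b)"
        if "a \<rightarrow> w0" "v2 \<rightarrow> b" for a b
      proof -
        have "a \<in> {v1, v2} \<or> a \<in> W"
          using nbr[OF adj_sym[OF that(1)]] middle w0 that(1) adj_sym by blast
        then have "a = v2 \<or> a \<rightarrow> v2" using adj middle by blast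
        then show ?thesis using that(2) by blast
      qed
      then show ?thesis
        using merge[of w0 v0] middle w0 v path_distinct by (auto simp: W_def base_eq_v0)
    qed
  qed
qed

lemma iso_path_four:
  assumes "card (verts G) = 4"
  shows "digraph_iso G (with_proj (path_graph 4))"
proof -
  let ?vs = "[v0, v1, v2, v3]"
  have "set ?vs = verts G"
    using assms path_verts path_distinct
    by (intro card_subset_eq) (auto simp: distinct_card[OF path_distinct])
  then have "bij_betw ((!) ?vs) {..<4} (verts G)"
    using path_distinct by (intro bij_betw_nth) auto
  moreover have "(?vs ! i \<rightarrow> ?vs ! j) \<longleftrightarrow> j = Suc i \<or> i = Suc j" if "i < 4" "j < 4" for i j
  proof -
    have "i = 0 \<or> i = 1 \<or> i = 2 \<or> i = 3" "j = 0 \<or> j = 1 \<or> j = 2 \<or> j = 3"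
      using that by arith+
    then show ?thesis
      by (elim disjE) (simp_all add: adj adj_rev nonadj ends_nonadj adj_irrefl)
  qed
  ultimately show ?thesis unfolding digraph_iso_path_graph_iff by blast
qed

end

section \<open>Small orders, lower bounds and the extremal paths\<close>

context graph
begin

text \<open>For a constant coloring the test concerns all walks with three arcs; a walk that fails
  it satisfies the assumptions of \<open>distance_three\<close>.\<close>

lemma locally_proper_const_or_distance_three:
  assumes "connected G"
  shows "locally_proper (\<lambda>_. ()) \<or> (\<exists>v0 v1 v2 v3. distance_three G v0 v1 v2 v3)"
proof (rule disjCI)
  assume "\<nexists>v0 v1 v2 v3. distance_three G v0 v1 v2 v3"
  then have no: "\<not> distance_three G v0 v1 v2 v3" for v0 v1 v2 v3 by blast
  have "a = b \<or> a \<rightarrow> b \<or> (\<exists>z. a \<rightarrow> z \<and> z \<rightarrow> b)" if "a \<rightarrow> x" "x \<rightarrow> y" "y \<rightarrow> b" for a x y b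
    using no[of a x y b] that assms graph_axioms
    by (auto simp: distance_three_def distance_three_axioms_def graph_def)
  then show "locally_proper (\<lambda>_. ())" unfolding locally_proper_def by blast
qed

lemma path_between_first_step:
  assumes "path_between G u p v" "u \<noteq> v"
  obtains x q where "p = u # x # q" "u \<rightarrow> x" "path_between G x (x # q) v"
proof -
  obtain x q where p: "p = u # x # q"
    using assms by (cases p rule: vwalk_arcs.cases) (auto simp: path_between_def vpath_def)
  moreover have "u \<rightarrow> x" "path_between G x (x # q) v"
    using assms(1) unfolding p path_between_def vpath_def vwalk_def by auto
  ultimately show thesis using that by blast
qed

lemma ex_adj:
  assumes "connected G" "u \<in> verts G" "v \<in> verts G" "u \<noteq> v"
  shows "\<exists>x. u \<rightarrow> x"
  using ex_geodesic[OF assms(1-3)] path_between_first_step assms(4)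
  by (metis geodesic_def)

lemma not_complete_nonadj:
  assumes "\<not> complete_digraph (card (verts G)) G"
  obtains u v where "u \<in> verts G" "v \<in> verts G" "u \<noteq> v" "\<not> u \<rightarrow> v"
proof -
  have "arcs_ends G \<noteq> {(u, v). (u, v) \<in> verts G \<times> verts G \<and> u \<noteq> v}"
    using assms graph_axioms by (auto simp: complete_digraph_def)
  moreover have "arcs_ends G \<subseteq> {(u, v). (u, v) \<in> verts G \<times> verts G \<and> u \<noteq> v}"
    using adj_irrefl by auto
  ultimately show thesis using that by blast
qed

text \<open>Two nonadjacent vertices and a neighbor of one of them are three distinct
  vertices.\<close>

lemma not_complete_card_ge_3:
  assumes "connected G" "\<not> complete_digraph (card (verts G)) G"
  shows "3 \<le> card (verts G)"
proof -
  obtain u v where uv: "u \<in> verts G" "v \<in> verts G" "u \<noteq> v" "\<not> u \<rightarrow> v"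
    using not_complete_nonadj[OF assms(2)] .
  obtain x where x: "u \<rightarrow> x" using ex_adj[OF assms(1) uv(1-3)] by blast
  have "card {u, v, x} \<le> card (verts G)"
    using uv x by (intro card_mono) auto
  moreover have "x \<noteq> u" "x \<noteq> v" using uv x adj_irrefl by auto
  ultimately show ?thesis using uv(3) by auto
qed

text \<open>The third vertex is the only possible neighbor of each of two nonadjacent ones.\<close>

lemma iso_path_three:
  assumes "connected G" "card (verts G) = 3" "\<not> complete_digraph 3 G"
  shows "digraph_iso G (with_proj (path_graph 3))"
proof -
  obtain u v where uv: "u \<in> verts G" "v \<in> verts G" "u \<noteq> v" "\<not> u \<rightarrow> v"
    using not_complete_nonadj assms(2,3) by metis
  have "card (verts G - {u, v}) = 1" using uv assms(2) by (simp add: card_Diff_subset)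
  then obtain w where w: "verts G - {u, v} = {w}" by (auto simp: card_1_singleton_iff)
  then have V: "verts G = {u, w, v}" "w \<noteq> u" "w \<noteq> v" using uv by auto
  have "u \<rightarrow> w"
    using ex_adj[OF assms(1) uv(1,2,3)] V uv adj_irrefl by (metis adj_in_verts(2) insertE singletonD)
  moreover have "v \<rightarrow> w"
    using ex_adj[OF assms(1) uv(2,1)] V uv adj_irrefl adj_sym
    by (metis adj_in_verts(2) insertE singletonD)
  ultimately have adj: "u \<rightarrow> w" "w \<rightarrow> u" "v \<rightarrow> w" "w \<rightarrow> v" "\<not> v \<rightarrow> u"
    using uv adj_sym by blast+
  let ?vs = "[u, w, v]"
  have "bij_betw ((!) ?vs) {..<3} (verts G)"
    using V uv by (intro bij_betw_nth) auto
  moreover have "(?vs ! i \<rightarrow> ?vs ! j) \<longleftrightarrow> j = Suc i \<or> i = Suc j" if "i < 3" "j < 3" for i j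
  proof -
    have "i = 0 \<or> i = 1 \<or> i = 2" "j = 0 \<or> j = 1 \<or> j = 2"
      using that by arith+
    then show ?thesis
      by (elim disjE) (simp_all add: adj uv adj_irrefl)
  qed
  ultimately show ?thesis unfolding digraph_iso_path_graph_iff by blast
qed

lemma iso_path_imp:
  assumes "digraph_iso G (with_proj (path_graph m))" "3 \<le> m"
  shows "card (verts G) = m" "\<not> complete_digraph k G"
proof -
  obtain g where g: "bij_betw g {..<m} (verts G)"
    and adj: "\<And>i j. i < m \<Longrightarrow> j < m \<Longrightarrow> (g i \<rightarrow> g j) \<longleftrightarrow> j = Suc i \<or> i = Suc j"
    using assms(1) unfolding digraph_iso_path_graph_iff by blast
  show "card (verts G) = m" using bij_betw_same_card[OF g] by simp
  have "g 0 \<noteq> g 2" "g 0 \<in> verts G" "g 2 \<in> verts G"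
    using g assms(2) inj_onD[of g "{..<m}" 0 2] by (auto simp: bij_betw_def)
  moreover have "\<not> g 0 \<rightarrow> g 2" using adj[of 0 2] assms(2) by auto
  ultimately show "\<not> complete_digraph k G" by (auto simp: complete_digraph_def)
qed

lemma spvc_pos:
  assumes "connected G" "\<not> complete_digraph (card (verts G)) G"
  shows "1 \<le> spvc G"
proof -
  obtain c :: "'a \<Rightarrow> nat" where "c ` verts G \<subseteq> {..<spvc G}"
    using spvc_coloring[OF assms] by blast
  moreover have "verts G \<noteq> {}" using assms(1) by (simp add: connected_conv)
  ultimately show ?thesis by (cases "spvc G") auto
qed

text \<open>The only path between the ends runs through all four vertices, so its two inner vertices
  need different colors.\<close>

lemma spvc_path_four:
  assumes "connected G" "digraph_iso G (with_proj (path_graph 4))"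
  shows "2 \<le> spvc G"
proof -
  obtain g where g: "bij_betw g {..<4} (verts G)"
    and adj: "\<And>i j. i < 4 \<Longrightarrow> j < 4 \<Longrightarrow> (g i \<rightarrow> g j) \<longleftrightarrow> j = Suc i \<or> i = Suc j"
    using assms(2) unfolding digraph_iso_path_graph_iff by blast
  have V: "verts G = {g 0, g 1, g 2, g 3}"
    using g by (auto simp: bij_betw_def lessThan_nat_numeral lessThan_Suc numeral_eq_Suc)
  have neq: "g i \<noteq> g j" if "i < 4" "j < 4" "i \<noteq> j" for i j
    using g that by (auto simp: bij_betw_def inj_on_def)
  obtain c :: "'a \<Rightarrow> nat" where c: "c ` verts G \<subseteq> {..<spvc G}"
    and sp: "strong_proper_vertex_connected G c"
    using spvc_coloring[OF assms(1) iso_path_imp(2)[OF assms(2)]] by auto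
  obtain p where p: "path_between G (g 0) p (g 3)" and proper: "vertex_proper c p"
    using sp V by (auto simp: strong_proper_vertex_connected_def geodesic_def)
  obtain x q where 1: "p = g 0 # x # q" "g 0 \<rightarrow> x" "path_between G x (x # q) (g 3)"
    using path_between_first_step[OF p] neq[of 0 3] by auto
  have "x \<in> verts G" using 1 by auto
  then have x: "x = g 1" using 1 V adj[of 0] by auto
  obtain y r where 2: "q = y # r" "g 1 \<rightarrow> y" "path_between G y (y # r) (g 3)"
    using path_between_first_step[OF 1(3)] neq[of 1 3] x by auto
  have "y \<in> verts G" using 2 by auto
  moreover have "y \<noteq> g 0" using p 1 2 by (auto simp: path_between_def vpath_def)
  ultimately have y: "y = g 2" using 2 V adj[of 1] by auto
  \<comment> \<open>As \<open>g 2\<close> is not the end of \<open>p\<close>, it survives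
    \<open>butlast\<close> and is internal.\<close>
  have "r \<noteq> []" using 2 y neq[of 2 3] by (auto simp: path_between_def)
  then have "c (g 1) \<noteq> c (g 2)"
    using proper 1 2 x y by (auto simp: vertex_proper_def internal_verts_def)
  moreover have "c (g 1) < spvc G" "c (g 2) < spvc G" using c V by auto
  ultimately show ?thesis by linarith
qed

end

text \<open>Order 2 is excluded from the equality statement because a single edge is complete and
  has \<open>spvc\<close> equal to 0 = 2 - 2.\<close>

theorem theorem6:
  fixes G :: "('a, 'b) pre_digraph" and n :: nat
  assumes "graph G" and "connected G"
    and "card (verts G) = n" and "2 \<le> n"
  shows "0 \<le> spvc G \<and> spvc G \<le> n - 2 \<and>
    (3 \<le> n \<longrightarrow>
      (spvc G = n - 2 \<longleftrightarrow>
        digraph_iso G (with_proj (path_graph 3)) \<or> digraph_iso G (with_proj (path_graph 4))))"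
proof -
  interpret graph G by fact
  have complete: "spvc G = 0" if "complete_digraph (card (verts G)) G"
    using that by (simp add: spvc_def)
  have const: "spvc G \<le> 1" if "locally_proper (\<lambda>_. ())"
  proof -
    have "card ((\<lambda>_. ()) ` verts G) \<le> card {()}" by (intro card_mono) auto
    then show ?thesis using spvc_le_card[OF assms(2) that] by simp
  qed
  have le: "spvc G \<le> n - 2"
  proof (cases "complete_digraph (card (verts G)) G")
    case False
    then have "3 \<le> n" using not_complete_card_ge_3 assms(2,3) by blast
    then show ?thesis
      using locally_proper_const_or_distance_three[OF assms(2)] const
        distance_three.spvc_le assms(3,4) by fastforce
  qed (use complete in simp)
  moreover have "spvc G = n - 2 \<longleftrightarrow>
      digraph_iso G (with_proj (path_graph 3)) \<or> digraph_iso G (with_proj (path_graph 4))"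
    (is "_ \<longleftrightarrow> ?P3 \<or> ?P4") if n: "3 \<le> n"
  proof
    assume eq: "spvc G = n - 2"
    then have nc: "\<not> complete_digraph n G" using complete n assms(3) by fastforce
    show "?P3 \<or> ?P4"
    proof (cases "n = 3")
      case True
      then show ?thesis using iso_path_three assms nc by blast
    next
      case False
      \<comment> \<open>Now n - 2 is at least 2, more than one color.\<close>
      then have "\<not> locally_proper (\<lambda>_. ())" using const eq n by auto
      then obtain v0 v1 v2 v3 where "distance_three G v0 v1 v2 v3"
        using locally_proper_const_or_distance_three[OF assms(2)] by blast
      then interpret distance_three G v0 v1 v2 v3 .
      \<comment> \<open>From order 5 on, the bound n - 3 contradicts equality.\<close>
      have "n = 4" using spvc_le_five eq n False assms(3) by fastforce
      then show ?thesis using iso_path_four assms(3) by blast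
    qed
  next
    assume "?P3 \<or> ?P4"
    then show "spvc G = n - 2"
    proof
      assume iso: ?P3
      show ?thesis using iso_path_imp[OF iso] spvc_pos[OF assms(2)] le assms(3) by fastforce
    next
      assume iso: ?P4
      show ?thesis using iso_path_imp[OF iso] spvc_path_four[OF assms(2) iso] le assms(3) by fastforce
    qed
  qed
  ultimately show ?thesis by blast
qed

end
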